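(* The class $\mathcal K_\omega$ of all countable ordered local orders $(O,<,\to)$ has the automorphic Borel amalgamation property (ABAP).
   Context: A local order is a tournament $(O,\to)$ such that for every vertex $x$, the set of predecessors of $x$ and the set of successors of $x$ are each linearly ordered by $\to$. An ordered local order is a structure $(O,<,\to)$ where $<$ is a (strict) linear order on $O$ and $(O,\to)$ is a local order, with no further relation required between them. ABAP. Let $\mathcal K_\omega$ be a class of countable relational structures in a fixed countable relational language, closed under isomorphism; it is regarded as a standard Borel space in the usual way (coding structures with universe a subset of $\mathbb N$). For $A\in\mathcal K_\omega$, a quantifier-free type $\tau(x)$ in one free variable with finitely many parameters from $A$ is an admissible finite type over $A$ if there is $B\in\mathcal K_\omega$ with $A$ a substructure of $B$ and $B$ containing an element realizing $\tau$. The class $\mathcal K_\omega$ has the ABAP if there is a Borel map $E$ on $\mathcal K_\omega$ such that: (a) for every $A\in\mathcal K_\omega$, $E(A)\in\mathcal K_\omega$ is an extension of $A$ containing witnesses for all admissible finite types over $A$; (b) there is a Borel assignment $(A,\phi)\mapsto\tilde\phi$, from pairs with $A\in\mathcal K_\omega$ and $\phi\in\mathrm{Aut}(A)$, to $\tilde\phi\in\mathrm{Aut}(E(A))$ such that $\phi\subseteq\tilde\phi$ and $\tilde\phi$ has no fixed points in $E(A)\setminus A$; (c) there is an assignment $(A_0,A_1,\alpha)\mapsto\hat\alpha$, from triples with $A_i\in\mathcal K_\omega$ and $\alpha\colon A_0\cong A_1$ an isomorphism, to isomorphisms $\hat\alpha\colon E(A_0)\cong E(A_1)$ extending $\alpha$,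 such that whenever $\phi_i\in\mathrm{Aut}(A_i)$ and $\alpha\phi_0=\phi_1\alpha$, we have $\hat\alpha\tilde\phi_0=\tilde\phi_1\hat\alpha$. *)

theory Defs
  imports "HOL-Analysis.Analysis"
begin

section \<open>Coded countable relational structures\<close>

text \<open>A language is a countable type \<open>'r\<close> of relation symbols together with an arity function
  \<open>ar\<close>.  A countable structure is coded on a (finite or infinite, possibly empty) subset of
  the natural numbers.\<close>

record 'r rstruct =
  universe :: "nat set"
  interp :: "'r \<Rightarrow> nat list set"

definition is_structure :: "('r \<Rightarrow> nat) \<Rightarrow> 'r rstruct \<Rightarrow> bool" where
  "is_structure ar A \<longleftrightarrow> (\<forall>r. \<forall>xs \<in> interp A r. length xs = ar r \<and> set xs \<subseteq> universe A)"

text \<open>Maps between coded structures are represented by functions on \<open>nat\<close> that take the default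
  value \<open>undefined\<close> outside the domain structure, so that a map between structures has exactly
  one representative.\<close>

definition embeddings :: "'r rstruct \<Rightarrow> 'r rstruct \<Rightarrow> (nat \<Rightarrow> nat) set" where
  "embeddings A B = {f \<in> universe A \<rightarrow>\<^sub>E universe B. inj_on f (universe A) \<and>
     (\<forall>r. \<forall>xs \<in> lists (universe A). xs \<in> interp A r \<longleftrightarrow> map f xs \<in> interp B r)}"

definition isos :: "'r rstruct \<Rightarrow> 'r rstruct \<Rightarrow> (nat \<Rightarrow> nat) set" where
  "isos A B = {f \<in> embeddings A B. f ` universe A = universe B}"

definition Aut :: "'r rstruct \<Rightarrow> (nat \<Rightarrow> nat) set" where
  "Aut A = isos A A"

text \<open>The usual Borel structure: identify a structure with the characteristic functions of its
  universe and of its relations, i.e. with a point of a countable product of copies of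
  \<open>{0, 1}\<close>; the product sigma-algebra is generated by the coordinate sets below.\<close>

definition struct_borel :: "'r::countable rstruct measure" where
  "struct_borel = sigma UNIV
     ((\<Union>n. {{A. n \<in> universe A}}) \<union> (\<Union>r. \<Union>xs. {{A. xs \<in> interp A r}}))"

definition borel_class :: "('r::countable \<Rightarrow> nat) \<Rightarrow> 'r rstruct set \<Rightarrow> bool" where
  "borel_class ar K \<longleftrightarrow> (\<forall>A \<in> K. is_structure ar A) \<and>
     (\<forall>A \<in> K. \<forall>B. is_structure ar B \<and> isos A B \<noteq> {} \<longrightarrow> B \<in> K) \<and>
     K \<in> sets struct_borel"

section \<open>Quantifier-free types in one variable\<close>

datatype qf_term = Var | Par nat

datatype 'r qf_formula =
    Falsum
  | Equal qf_term qf_term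
  | Atom 'r "qf_term list"
  | Neg "'r qf_formula"
  | Conj "'r qf_formula" "'r qf_formula"

primrec term_params :: "qf_term \<Rightarrow> nat set" where
  "term_params Var = {}"
| "term_params (Par a) = {a}"

primrec params :: "'r qf_formula \<Rightarrow> nat set" where
  "params Falsum = {}"
| "params (Equal s t) = term_params s \<union> term_params t"
| "params (Atom r ts) = (\<Union>t \<in> set ts. term_params t)"
| "params (Neg \<psi>) = params \<psi>"
| "params (Conj \<psi> \<theta>) = params \<psi> \<union> params \<theta>"

primrec well_formed :: "('r \<Rightarrow> nat) \<Rightarrow> 'r qf_formula \<Rightarrow> bool" where
  "well_formed ar Falsum \<longleftrightarrow> True"
| "well_formed ar (Equal s t) \<longleftrightarrow> True"
| "well_formed ar (Atom r ts) \<longleftrightarrow> length ts = ar r"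
| "well_formed ar (Neg \<psi>) \<longleftrightarrow> well_formed ar \<psi>"
| "well_formed ar (Conj \<psi> \<theta>) \<longleftrightarrow> well_formed ar \<psi> \<and> well_formed ar \<theta>"

text \<open>Satisfaction in \<open>B\<close> of a formula with parameters from a structure embedded into \<open>B\<close>
  by \<open>f\<close>: the variable denotes \<open>b\<close> and the parameter \<open>a\<close> denotes \<open>f a\<close>.\<close>

primrec term_val :: "(nat \<Rightarrow> nat) \<Rightarrow> nat \<Rightarrow> qf_term \<Rightarrow> nat" where
  "term_val f b Var = b"
| "term_val f b (Par a) = f a"

primrec qf_sat :: "'r rstruct \<Rightarrow> (nat \<Rightarrow> nat) \<Rightarrow> nat \<Rightarrow> 'r qf_formula \<Rightarrow> bool" where
  "qf_sat B f b Falsum \<longleftrightarrow> False"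
| "qf_sat B f b (Equal s t) \<longleftrightarrow> term_val f b s = term_val f b t"
| "qf_sat B f b (Atom r ts) \<longleftrightarrow> map (term_val f b) ts \<in> interp B r"
| "qf_sat B f b (Neg \<psi>) \<longleftrightarrow> \<not> qf_sat B f b \<psi>"
| "qf_sat B f b (Conj \<psi> \<theta>) \<longleftrightarrow> qf_sat B f b \<psi> \<and> qf_sat B f b \<theta>"

definition realizes :: "'r rstruct \<Rightarrow> (nat \<Rightarrow> nat) \<Rightarrow> nat \<Rightarrow> 'r qf_formula set \<Rightarrow> bool" where
  "realizes B f b \<tau> \<longleftrightarrow> b \<in> universe B \<and> (\<forall>\<psi> \<in> \<tau>. qf_sat B f b \<psi>)"

text \<open>Types need not be complete.  This makes no difference for the existence of witnesses: an
  element realizing a partial type over a finite parameter set also realizes a complete type over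
  that set extending it.\<close>

definition finite_qf_type :: "('r \<Rightarrow> nat) \<Rightarrow> 'r rstruct \<Rightarrow> 'r qf_formula set \<Rightarrow> bool" where
  "finite_qf_type ar A \<tau> \<longleftrightarrow>
     (\<exists>F. finite F \<and> F \<subseteq> universe A \<and> (\<forall>\<psi> \<in> \<tau>. well_formed ar \<psi> \<and> params \<psi> \<subseteq> F))"

text \<open>A structure with universe \<open>UNIV\<close> has no proper superstructure coded on a subset of \<open>nat\<close>.
  Since \<open>K\<close> is closed under isomorphism, the extensions of \<open>A\<close> in \<open>K\<close> are, up to isomorphism
  over \<open>A\<close>, the embeddings of \<open>A\<close> into coded members of \<open>K\<close>.  Extensions are therefore
  presented by embeddings here and in \<open>ABAP\<close> below.\<close>

definition admissible :: "('r \<Rightarrow> nat) \<Rightarrow> 'r rstruct set \<Rightarrow> 'r rstruct \<Rightarrow> 'r qf_formula set \<Rightarrow> bool"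
  where
  "admissible ar K A \<tau> \<longleftrightarrow> finite_qf_type ar A \<tau> \<and>
     (\<exists>B \<in> K. \<exists>f \<in> embeddings A B. \<exists>b. realizes B f b \<tau>)"

section \<open>The automorphic Borel amalgamation property\<close>

text \<open>The extension of \<open>A\<close> is \<open>\<iota> A\<close>, an embedding of \<open>A\<close> into \<open>E A\<close> that depends on \<open>A\<close> in a
  Borel way; \<open>t (A, \<phi>)\<close> and \<open>h A\<^sub>0 A\<^sub>1 \<alpha>\<close> are the extensions of \<open>\<phi>\<close> and of \<open>\<alpha>\<close>.  The type
  \<open>nat \<Rightarrow> nat\<close> carries the Borel sets of the product of discrete topologies.\<close>

definition ABAP :: "('r::countable \<Rightarrow> nat) \<Rightarrow> 'r rstruct set \<Rightarrow> bool" where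
  "ABAP ar K \<longleftrightarrow>
    (\<exists>(E :: 'r rstruct \<Rightarrow> 'r rstruct) (\<iota> :: 'r rstruct \<Rightarrow> nat \<Rightarrow> nat)
      (t :: 'r rstruct \<times> (nat \<Rightarrow> nat) \<Rightarrow> nat \<Rightarrow> nat)
      (h :: 'r rstruct \<Rightarrow> 'r rstruct \<Rightarrow> (nat \<Rightarrow> nat) \<Rightarrow> nat \<Rightarrow> nat).
      E \<in> restrict_space struct_borel K \<rightarrow>\<^sub>M restrict_space struct_borel K \<and>
      \<iota> \<in> restrict_space struct_borel K \<rightarrow>\<^sub>M borel \<and>
      (\<forall>A \<in> K. \<iota> A \<in> embeddings A (E A) \<and>
        (\<forall>\<tau>. admissible ar K A \<tau> \<longrightarrow> (\<exists>c. realizes (E A) (\<iota> A) c \<tau>))) \<and>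
      t \<in> restrict_space (struct_borel \<Otimes>\<^sub>M borel) (SIGMA A : K. Aut A) \<rightarrow>\<^sub>M borel \<and>
      (\<forall>A \<in> K. \<forall>\<phi> \<in> Aut A.
        t (A, \<phi>) \<in> Aut (E A) \<and>
        (\<forall>x \<in> universe A. t (A, \<phi>) (\<iota> A x) = \<iota> A (\<phi> x)) \<and>
        (\<forall>y \<in> universe (E A) - \<iota> A ` universe A. t (A, \<phi>) y \<noteq> y)) \<and>
      (\<forall>A\<^sub>0 \<in> K. \<forall>A\<^sub>1 \<in> K. \<forall>\<alpha> \<in> isos A\<^sub>0 A\<^sub>1.
        h A\<^sub>0 A\<^sub>1 \<alpha> \<in> isos (E A\<^sub>0) (E A\<^sub>1) \<and>
        (\<forall>x \<in> universe A\<^sub>0. h A\<^sub>0 A\<^sub>1 \<alpha> (\<iota> A\<^sub>0 x) = \<iota> A\<^sub>1 (\<alpha> x)) \<and>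
        (\<forall>\<phi>\<^sub>0 \<in> Aut A\<^sub>0. \<forall>\<phi>\<^sub>1 \<in> Aut A\<^sub>1.
          (\<forall>x \<in> universe A\<^sub>0. \<alpha> (\<phi>\<^sub>0 x) = \<phi>\<^sub>1 (\<alpha> x)) \<longrightarrow>
          (\<forall>y \<in> universe (E A\<^sub>0).
            h A\<^sub>0 A\<^sub>1 \<alpha> (t (A\<^sub>0, \<phi>\<^sub>0) y) = t (A\<^sub>1, \<phi>\<^sub>1) (h A\<^sub>0 A\<^sub>1 \<alpha> y)))))"

section \<open>Ordered local orders\<close>

definition tournament_on :: "'a set \<Rightarrow> 'a rel \<Rightarrow> bool" where
  "tournament_on V R \<longleftrightarrow> R \<subseteq> V \<times> V \<and> asym R \<and> total_on V R"

definition local_order_on :: "'a set \<Rightarrow> 'a rel \<Rightarrow> bool" where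
  "local_order_on V R \<longleftrightarrow> tournament_on V R \<and>
     (\<forall>x \<in> V. strict_linear_order_on (R\<inverse> `` {x}) (Restr R (R\<inverse> `` {x})) \<and>
              strict_linear_order_on (R `` {x}) (Restr R (R `` {x})))"

datatype olo_symbol = Less | Arrow

instance olo_symbol :: countable
  by countable_datatype

abbreviation olo_arity :: "olo_symbol \<Rightarrow> nat" where
  "olo_arity \<equiv> (\<lambda>_. 2)"

definition binrel :: "'r rstruct \<Rightarrow> 'r \<Rightarrow> nat rel" where
  "binrel A r = {(x, y). [x, y] \<in> interp A r}"

definition ordered_local_orders :: "olo_symbol rstruct set" where
  "ordered_local_orders = {A. is_structure olo_arity A \<and>
     strict_linear_order_on (universe A) (binrel A Less) \<and>
     local_order_on (universe A) (binrel A Arrow)}"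

text \<open>The class satisfies the standing assumptions made on the classes for which ABAP is
  defined; in particular it is a standard Borel space as a Borel set of codes.\<close>

lemma embeddings_binrel_iff:
  assumes "f \<in> embeddings A B" "x \<in> universe A" "y \<in> universe A"
  shows "(f x, f y) \<in> binrel B r \<longleftrightarrow> (x, y) \<in> binrel A r"
proof -
  have "[x, y] \<in> lists (universe A)" using assms by simp
  then have "[x, y] \<in> interp A r \<longleftrightarrow> map f [x, y] \<in> interp B r"
    using assms(1) unfolding embeddings_def by blast
  then show ?thesis by (simp add: binrel_def)
qed

lemma isos_inverse:
  assumes "f \<in> isos A B"
  shows "embeddings B A \<noteq> {}"
proof -
  have inj: "inj_on f (universe A)" and im: "f ` universe A = universe B"
    using assms by (auto simp: isos_def embeddings_def)
  have pres: "xs \<in> interp A r \<longleftrightarrow> map f xs \<in> interp B r" if "xs \<in> lists (universe A)" for xs r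
    using assms that unfolding isos_def embeddings_def by blast
  define g where "g = restrict (the_inv_into (universe A) f) (universe B)"
  have g: "g y \<in> universe A" "f (g y) = y" if "y \<in> universe B" for y
    using that inj im the_inv_into_into[of f "universe A" y "universe A"] f_the_inv_into_f[of f "universe A" y]
    by (auto simp: g_def)
  have "\<forall>r. \<forall>ys \<in> lists (universe B). ys \<in> interp B r \<longleftrightarrow> map g ys \<in> interp A r"
  proof (intro allI ballI)
    fix r ys assume ys: "ys \<in> lists (universe B)"
    have "map f (map g ys) = ys"
      using ys g(2) by (simp add: map_idI in_lists_conv_set)
    moreover have "map g ys \<in> lists (universe A)"
      using ys g(1) by (auto simp: in_lists_conv_set)
    ultimately show "ys \<in> interp B r \<longleftrightarrow> map g ys \<in> interp A r" using pres[of "map g ys" r] by simp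
  qed
  moreover have "inj_on g (universe B)"
    using g(2) by (intro inj_onI) metis
  moreover have "g \<in> universe B \<rightarrow>\<^sub>E universe A"
    using g(1) by (auto simp: g_def)
  ultimately have "g \<in> embeddings B A" unfolding embeddings_def by simp
  then show ?thesis by blast
qed

lemma ordered_local_orders_iff:
  "A \<in> ordered_local_orders \<longleftrightarrow> is_structure olo_arity A \<and>
    (\<forall>x. (x, x) \<notin> binrel A Less) \<and>
    (\<forall>x y z. (x, y) \<in> binrel A Less \<longrightarrow> (y, z) \<in> binrel A Less \<longrightarrow> (x, z) \<in> binrel A Less) \<and>
    (\<forall>x y. x \<in> universe A \<longrightarrow> y \<in> universe A \<longrightarrow> x \<noteq> y \<longrightarrow>
      (x, y) \<in> binrel A Less \<or> (y, x) \<in> binrel A Less) \<and>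
    (\<forall>x y. (x, y) \<in> binrel A Arrow \<longrightarrow> (y, x) \<notin> binrel A Arrow) \<and>
    (\<forall>x y. x \<in> universe A \<longrightarrow> y \<in> universe A \<longrightarrow> x \<noteq> y \<longrightarrow>
      (x, y) \<in> binrel A Arrow \<or> (y, x) \<in> binrel A Arrow) \<and>
    (\<forall>w x y z.
      ((x, w) \<in> binrel A Arrow \<and> (y, w) \<in> binrel A Arrow \<and> (z, w) \<in> binrel A Arrow \<or>
       (w, x) \<in> binrel A Arrow \<and> (w, y) \<in> binrel A Arrow \<and> (w, z) \<in> binrel A Arrow) \<longrightarrow>
      (x, y) \<in> binrel A Arrow \<longrightarrow> (y, z) \<in> binrel A Arrow \<longrightarrow> (x, z) \<in> binrel A Arrow)"
    (is "_ \<longleftrightarrow> ?S \<and> ?L1 \<and> ?L2 \<and> ?L3 \<and> ?R1 \<and> ?R2 \<and> ?R3")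
proof (cases ?S)
  case True
  have sub: "binrel A r \<subseteq> universe A \<times> universe A" for r
    using True by (fastforce simp: is_structure_def binrel_def)
  have L: "strict_linear_order_on (universe A) (binrel A Less) \<longleftrightarrow> ?L1 \<and> ?L2 \<and> ?L3"
  proof -
    have "irrefl (binrel A Less) \<longleftrightarrow> ?L1" "trans (binrel A Less) \<longleftrightarrow> ?L2"
      by (simp_all add: irrefl_def trans_def)
    moreover have "total_on (universe A) (binrel A Less) \<longleftrightarrow> ?L3"
      by (auto simp: total_on_def)
    ultimately show ?thesis unfolding strict_linear_order_on_def by argo
  qed
  have T: "tournament_on (universe A) (binrel A Arrow) \<longleftrightarrow> ?R1 \<and> ?R2"
  proof -
    have "asym (binrel A Arrow) \<longleftrightarrow> ?R1"
      by (simp add: asym_iff)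
    moreover have "total_on (universe A) (binrel A Arrow) \<longleftrightarrow> ?R2"
      by (auto simp: total_on_def)
    ultimately show ?thesis using sub[of Arrow] unfolding tournament_on_def by argo
  qed
  let ?R = "binrel A Arrow"
  have P: "strict_linear_order_on S (Restr ?R S) \<longleftrightarrow>
      (\<forall>x \<in> S. \<forall>y \<in> S. \<forall>z \<in> S. (x, y) \<in> ?R \<longrightarrow> (y, z) \<in> ?R \<longrightarrow> (x, z) \<in> ?R)"
    if "?R1" "?R2" "S \<subseteq> universe A" for S
  proof -
    have "irrefl (Restr ?R S)" using that(1) unfolding irrefl_def by blast
    moreover have "total_on S (Restr ?R S)" using that(2,3) unfolding total_on_def by blast
    moreover have "trans (Restr ?R S) \<longleftrightarrow>
        (\<forall>x \<in> S. \<forall>y \<in> S. \<forall>z \<in> S. (x, y) \<in> ?R \<longrightarrow> (y, z) \<in> ?R \<longrightarrow> (x, z) \<in> ?R)"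
      unfolding trans_def by auto
    ultimately show ?thesis unfolding strict_linear_order_on_def by simp
  qed
  have Q: "(\<forall>x \<in> universe A. strict_linear_order_on (?R\<inverse> `` {x}) (Restr ?R (?R\<inverse> `` {x})) \<and>
              strict_linear_order_on (?R `` {x}) (Restr ?R (?R `` {x}))) \<longleftrightarrow> ?R3" (is "?Q \<longleftrightarrow> _")
    if R: "?R1" "?R2"
  proof -
    have pre: "?R\<inverse> `` {w} \<subseteq> universe A" and succ: "?R `` {w} \<subseteq> universe A" for w
      using sub[of Arrow] by auto
    show ?thesis
      unfolding P[OF R pre] P[OF R succ]
    proof (intro iffI ballI conjI allI impI)
      fix w x y z
      assume h: "\<forall>w \<in> universe A.
          (\<forall>x \<in> ?R\<inverse> `` {w}. \<forall>y \<in> ?R\<inverse> `` {w}. \<forall>z \<in> ?R\<inverse> `` {w}.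
            (x, y) \<in> ?R \<longrightarrow> (y, z) \<in> ?R \<longrightarrow> (x, z) \<in> ?R) \<and>
          (\<forall>x \<in> ?R `` {w}. \<forall>y \<in> ?R `` {w}. \<forall>z \<in> ?R `` {w}.
            (x, y) \<in> ?R \<longrightarrow> (y, z) \<in> ?R \<longrightarrow> (x, z) \<in> ?R)"
        and w: "(x, w) \<in> ?R \<and> (y, w) \<in> ?R \<and> (z, w) \<in> ?R \<or>
          (w, x) \<in> ?R \<and> (w, y) \<in> ?R \<and> (w, z) \<in> ?R"
        and xyz: "(x, y) \<in> ?R" "(y, z) \<in> ?R"
      have "w \<in> universe A" using w sub[of Arrow] by auto
      note h' = bspec[OF h this]
      from w show "(x, z) \<in> ?R"
      proof
        assume "(x, w) \<in> ?R \<and> (y, w) \<in> ?R \<and> (z, w) \<in> ?R"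
        with conjunct1[OF h'] xyz show ?thesis by auto
      next
        assume "(w, x) \<in> ?R \<and> (w, y) \<in> ?R \<and> (w, z) \<in> ?R"
        with conjunct2[OF h'] xyz show ?thesis by auto
      qed
    next
      fix w x y z
      assume h: "?R3" and xyz: "(x, y) \<in> ?R" "(y, z) \<in> ?R"
      {
        assume "x \<in> ?R\<inverse> `` {w}" "y \<in> ?R\<inverse> `` {w}" "z \<in> ?R\<inverse> `` {w}"
        then show "(x, z) \<in> ?R" using h[rule_format, of x w y z] xyz by simp
      next
        assume "x \<in> ?R `` {w}" "y \<in> ?R `` {w}" "z \<in> ?R `` {w}"
        then show "(x, z) \<in> ?R" using h[rule_format, of x w y z] xyz by simp
      }
    qed
  qed
  show ?thesis
    unfolding ordered_local_orders_def local_order_on_def mem_Collect_eq L T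
    using True Q by argo
qed (simp add: ordered_local_orders_def)

lemma ordered_local_orders_hereditary:
  assumes f: "f \<in> embeddings A B" and B: "B \<in> ordered_local_orders"
    and A: "is_structure olo_arity A"
  shows "A \<in> ordered_local_orders"
proof -
  have sub: "x \<in> universe A" "y \<in> universe A" if "(x, y) \<in> binrel A r" for x y r
    using A that by (fastforce simp: is_structure_def binrel_def)+
  have iff: "(x, y) \<in> binrel A r \<longleftrightarrow> x \<in> universe A \<and> y \<in> universe A \<and> (f x, f y) \<in> binrel B r" for x y r
    using embeddings_binrel_iff[OF f] sub by blast
  have img: "(f x, f y) \<in> binrel B r" if "(x, y) \<in> binrel A r" for x y r
    using iff that by simp
  have f_universe: "f x \<in> universe B" if "x \<in> universe A" for x
    using f that by (auto simp: embeddings_def)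
  have f_inj: "f x \<noteq> f y" if "x \<in> universe A" "y \<in> universe A" "x \<noteq> y" for x y
    using f that by (auto simp: embeddings_def inj_on_def)
  note B' = B[unfolded ordered_local_orders_iff, THEN conjunct2]
  note L1 = B'[THEN conjunct1] and L2 = B'[THEN conjunct2, THEN conjunct1]
    and L3 = B'[THEN conjunct2, THEN conjunct2, THEN conjunct1]
  note B'' = B'[THEN conjunct2, THEN conjunct2, THEN conjunct2]
  note R1 = B''[THEN conjunct1] and R2 = B''[THEN conjunct2, THEN conjunct1]
    and R3 = B''[THEN conjunct2, THEN conjunct2]
  show ?thesis
    unfolding ordered_local_orders_iff
  proof (intro conjI allI impI)
    show "is_structure olo_arity A" by (fact A)
    show "(x, x) \<notin> binrel A Less" for x
      using L1 iff by simp
    show "(x, z) \<in> binrel A Less" if "(x, y) \<in> binrel A Less" "(y, z) \<in> binrel A Less" for x y z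
    proof -
      have "(f x, f z) \<in> binrel B Less"
        using L2[rule_format, OF img img] that by simp
      then show ?thesis using sub(1)[OF that(1)] sub(2)[OF that(2)] iff by simp
    qed
    show "(x, y) \<in> binrel A Less \<or> (y, x) \<in> binrel A Less"
      if "x \<in> universe A" "y \<in> universe A" "x \<noteq> y" for x y
      using L3[rule_format, OF f_universe f_universe f_inj] that iff by simp
    show "(y, x) \<notin> binrel A Arrow" if "(x, y) \<in> binrel A Arrow" for x y
      using R1[rule_format, OF img[OF that]] iff by simp
    show "(x, y) \<in> binrel A Arrow \<or> (y, x) \<in> binrel A Arrow"
      if "x \<in> universe A" "y \<in> universe A" "x \<noteq> y" for x y
      using R2[rule_format, OF f_universe f_universe f_inj] that iff by simp
    show "(x, z) \<in> binrel A Arrow"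
      if h: "(x, w) \<in> binrel A Arrow \<and> (y, w) \<in> binrel A Arrow \<and> (z, w) \<in> binrel A Arrow \<or>
          (w, x) \<in> binrel A Arrow \<and> (w, y) \<in> binrel A Arrow \<and> (w, z) \<in> binrel A Arrow"
        and xy: "(x, y) \<in> binrel A Arrow" and yz: "(y, z) \<in> binrel A Arrow" for w x y z
    proof -
      have "(f x, f w) \<in> binrel B Arrow \<and> (f y, f w) \<in> binrel B Arrow \<and> (f z, f w) \<in> binrel B Arrow \<or>
          (f w, f x) \<in> binrel B Arrow \<and> (f w, f y) \<in> binrel B Arrow \<and> (f w, f z) \<in> binrel B Arrow"
        using h img by blast
      moreover have "(f x, f y) \<in> binrel B Arrow" "(f y, f z) \<in> binrel B Arrow"
        using img[OF xy] img[OF yz] by simp_all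
      ultimately have "(f x, f z) \<in> binrel B Arrow"
        using R3[rule_format, of "f x" "f w" "f y" "f z"] by simp
      then show ?thesis using sub(1)[OF xy] sub(2)[OF yz] iff by simp
    qed
  qed
qed

lemma pred_universe [measurable]: "Measurable.pred struct_borel (\<lambda>A. n \<in> universe A)"
  unfolding pred_def struct_borel_def
  by (auto simp: space_measure_of_conv intro!: sigma_sets.Basic)

lemma pred_interp [measurable]: "Measurable.pred struct_borel (\<lambda>A. xs \<in> interp A r)"
  unfolding pred_def struct_borel_def
  by (auto simp: space_measure_of_conv intro!: sigma_sets.Basic)

lemma borel_class_ordered_local_orders: "borel_class olo_arity ordered_local_orders"
  unfolding borel_class_def
proof (intro conjI ballI allI impI)
  show "is_structure olo_arity A" if "A \<in> ordered_local_orders" for A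
    using that by (simp add: ordered_local_orders_def)
  show "B \<in> ordered_local_orders"
    if "A \<in> ordered_local_orders" "is_structure olo_arity B \<and> isos A B \<noteq> {}" for A B
    using that isos_inverse ordered_local_orders_hereditary by blast
  have "Measurable.pred struct_borel (\<lambda>A. A \<in> ordered_local_orders)"
    unfolding ordered_local_orders_iff is_structure_def binrel_def mem_Collect_eq case_prod_conv
      Ball_def subset_iff
    by measurable
  then show "ordered_local_orders \<in> sets struct_borel"
    by (simp add: pred_def struct_borel_def space_measure_of_conv)
qed

end

theory Submission
  imports Defs
begin

text \<open>A local order embeds in the circle, with \<open>x \<rightarrow> y\<close> when \<open>y\<close> lies on the open half circle that
  starts at \<open>x\<close>, and a finite type is a gap between neighbouring elements and antipodes of
  elements.  Hence it suffices to add, for every pair \<open>(x, b)\<close>, points that are infinitesimally close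
  to \<open>x\<close> in the order \<open><\<close> and infinitesimally close to \<open>b\<close> or to its antipode on the circle.  The
  infinitesimals are the nonzero rationals: all ties can be broken canonically, so the construction
  is functorial, and multiplying the infinitesimals by 2 is an automorphism that commutes with all
  lifted isomorphisms and moves every new point.\<close>

section \<open>The extension\<close>

text \<open>The point \<open>0\<close> serves as a reference for the new points over the empty structure.\<close>

definition base :: "'r rstruct \<Rightarrow> nat set" where
  "base A = (if universe A = {} then {0} else universe A)"

text \<open>The point \<open>(x, (q, s), b)\<close> has the displacement \<open>q\<close> from \<open>x\<close> in the order and from \<open>b\<close>, or from
  the antipode of \<open>b\<close> if \<open>s\<close> holds, on the circle.\<close>

type_synonym tag = "rat \<times> bool"
type_synonym point = "nat \<times> tag \<times> nat"

text \<open>The sign only breaks ties. What matters is that this order is linear, is invariant under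
  multiplication of the displacements by a positive rational, and puts the tag of an old point
  between negative and positive displacements.\<close>

definition tag_less :: "tag \<Rightarrow> tag \<Rightarrow> bool" where
  "tag_less t u \<longleftrightarrow> fst t < fst u \<or> fst t = fst u \<and> snd t < snd u"

definition old_point :: "nat \<Rightarrow> point" where
  "old_point a = (a, (0, False), a)"

text \<open>\<open>x\<close> and \<open>b\<close> vary independently because \<open><\<close> and
  the arrow are unrelated. New points have nonzero displacement and so never coincide with old
  ones.\<close>

definition points :: "'r rstruct \<Rightarrow> point set" where
  "points A = {(x, t, b). x \<in> base A \<and> b \<in> base A \<and> fst t \<noteq> 0} \<union> old_point ` universe A"

fun less_point :: "olo_symbol rstruct \<Rightarrow> point \<Rightarrow> point \<Rightarrow> bool" where
  "less_point A (x, t, b) (y, u, c) \<longleftrightarrow> (x, y) \<in> binrel A Less \<or>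
     x = y \<and> (tag_less t u \<or> t = u \<and> (b, c) \<in> binrel A Less)"

text \<open>Every vertex \<open>b\<close> of the local order is replaced by a chain, ordered by tag
  and then by \<open><\<close> on first components. The sign enters only through the order of the
  tags.\<close>

fun chain_arrow :: "olo_symbol rstruct \<Rightarrow> point \<Rightarrow> point \<Rightarrow> bool" where
  "chain_arrow A (x, t, b) (y, u, c) \<longleftrightarrow> (b, c) \<in> binrel A Arrow \<or>
     b = c \<and> (tag_less t u \<or> t = u \<and> (x, y) \<in> binrel A Less)"

definition point_sign :: "point \<Rightarrow> bool" where
  "point_sign p = snd (fst (snd p))"

text \<open>Passing to the antipode of one of two points reverses the arrow between them.\<close>

primrec point_rel :: "olo_symbol rstruct \<Rightarrow> olo_symbol \<Rightarrow> point \<Rightarrow> point \<Rightarrow> bool" where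
  "point_rel A Less p q = less_point A p q"
| "point_rel A Arrow p q = (chain_arrow A p q \<noteq> (point_sign p \<noteq> point_sign q))"

definition enc :: "point \<Rightarrow> nat" where "enc = to_nat_on UNIV"
definition dec :: "nat \<Rightarrow> point" where "dec = from_nat_into UNIV"

lemma dec_enc [simp]: "dec (enc p) = p"
  by (simp add: dec_def enc_def)

lemma enc_dec [simp]: "enc (dec n) = n"
proof -
  \<comment> \<open>\<open>from_nat_into\<close> is injective on all of \<open>nat\<close> only for
    an infinite set.\<close>
  have "infinite (UNIV :: point set)"
    by (simp add: finite_prod)
  then show ?thesis by (simp add: dec_def enc_def)
qed

definition extension :: "olo_symbol rstruct \<Rightarrow> olo_symbol rstruct" where
  "extension A = \<lparr>universe = {n. dec n \<in> points A},
     interp = \<lambda>r. {[m, n] |m n. dec m \<in> points A \<and> dec n \<in> points A \<and>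
       point_rel A r (dec m) (dec n)}\<rparr>"

definition old_incl :: "'r rstruct \<Rightarrow> nat \<Rightarrow> nat" where
  "old_incl A = (\<lambda>a \<in> universe A. enc (old_point a))"

text \<open>The default case serves the empty structure: its reference point \<open>0\<close> must
  go to itself, whereas an isomorphism is \<open>undefined\<close> there.\<close>

definition base_map :: "'r rstruct \<Rightarrow> (nat \<Rightarrow> nat) \<Rightarrow> nat \<Rightarrow> nat" where
  "base_map A \<alpha> a = (if a \<in> universe A then \<alpha> a else a)"

fun point_map :: "'r rstruct \<Rightarrow> (nat \<Rightarrow> nat) \<Rightarrow> rat \<Rightarrow> point \<Rightarrow> point" where
  "point_map A \<alpha> k (x, (q, s), b) = (base_map A \<alpha> x, (k * q, s), base_map A \<alpha> b)"

definition lift :: "olo_symbol rstruct \<Rightarrow> rat \<Rightarrow> (nat \<Rightarrow> nat) \<Rightarrow> nat \<Rightarrow> nat" where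
  "lift A k \<alpha> = (\<lambda>n \<in> universe (extension A). enc (point_map A \<alpha> k (dec n)))"

lemma universe_extension [simp]: "n \<in> universe (extension A) \<longleftrightarrow> dec n \<in> points A"
  by (simp add: extension_def)

lemma binrel_extension [simp]:
  "(m, n) \<in> binrel (extension A) r \<longleftrightarrow> dec m \<in> points A \<and> dec n \<in> points A \<and> point_rel A r (dec m) (dec n)"
  by (auto simp: extension_def binrel_def)

lemma is_structure_extension: "is_structure olo_arity (extension A)"
  by (auto simp: is_structure_def extension_def)

section \<open>The extension is an ordered local order\<close>

lemma tag_less_irrefl [simp]: "\<not> tag_less t t"
  by (simp add: tag_less_def)

lemma tag_less_trans: "tag_less t u \<Longrightarrow> tag_less u v \<Longrightarrow> tag_less t v"
  by (auto simp: tag_less_def)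

lemma tag_less_total: "t \<noteq> u \<Longrightarrow> tag_less t u \<or> tag_less u t"
  by (cases t; cases u) (auto simp: tag_less_def)

locale olo =
  fixes A :: "olo_symbol rstruct"
  assumes olo: "A \<in> ordered_local_orders"
begin

lemmas olo_less = olo[unfolded ordered_local_orders_iff, THEN conjunct2]
lemmas olo_arrow = olo_less[THEN conjunct2, THEN conjunct2, THEN conjunct2]

lemma olo_structure: "is_structure olo_arity A"
  by (rule olo[unfolded ordered_local_orders_iff, THEN conjunct1])

lemma less_irrefl [simp]: "(x, x) \<notin> binrel A Less"
  using olo_less[THEN conjunct1] ..

lemma less_trans: "(x, y) \<in> binrel A Less \<Longrightarrow> (y, z) \<in> binrel A Less \<Longrightarrow> (x, z) \<in> binrel A Less"
  using olo_less[THEN conjunct2, THEN conjunct1] by blast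

lemma less_total:
  assumes "x \<in> base A" "y \<in> base A" "x \<noteq> y"
  shows "(x, y) \<in> binrel A Less \<or> (y, x) \<in> binrel A Less"
proof -
  \<comment> \<open>Over the empty structure the base is a singleton, so two different elements of
    it lie in the universe.\<close>
  have "x \<in> universe A" "y \<in> universe A" using assms by (auto simp: base_def split: if_splits)
  then show ?thesis using assms(3)
      olo_less[THEN conjunct2, THEN conjunct2, THEN conjunct1] by blast
qed

lemma arrow_asym: "(x, y) \<in> binrel A Arrow \<Longrightarrow> (y, x) \<notin> binrel A Arrow"
  using olo_arrow[THEN conjunct1] by blast

lemma arrow_irrefl [simp]: "(x, x) \<notin> binrel A Arrow"
  using arrow_asym by blast

lemma arrow_total:
  assumes "x \<in> base A" "y \<in> base A" "x \<noteq> y"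
  shows "(x, y) \<in> binrel A Arrow \<or> (y, x) \<in> binrel A Arrow"
proof -
  have "x \<in> universe A" "y \<in> universe A" using assms by (auto simp: base_def split: if_splits)
  then show ?thesis using assms(3)
      olo_arrow[THEN conjunct2, THEN conjunct1] by blast
qed

lemma arrow_local:
  assumes "(x, w) \<in> binrel A Arrow \<and> (y, w) \<in> binrel A Arrow \<and> (z, w) \<in> binrel A Arrow \<or>
       (w, x) \<in> binrel A Arrow \<and> (w, y) \<in> binrel A Arrow \<and> (w, z) \<in> binrel A Arrow"
    and "(x, y) \<in> binrel A Arrow" "(y, z) \<in> binrel A Arrow"
  shows "(x, z) \<in> binrel A Arrow"
  using olo_arrow[THEN conjunct2, THEN conjunct2, rule_format, OF assms] .

lemma binrel_universe: "(x, y) \<in> binrel A r \<Longrightarrow> x \<in> universe A \<and> y \<in> universe A"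
  using olo_structure by (fastforce simp: is_structure_def binrel_def)

lemma points_base: "(x, t, b) \<in> points A \<Longrightarrow> x \<in> base A \<and> b \<in> base A"
  by (auto simp: points_def old_point_def base_def split: if_splits)

lemma less_point_irrefl: "\<not> less_point A p p"
  by (cases p) simp

lemma less_point_trans: "less_point A p q \<Longrightarrow> less_point A q r \<Longrightarrow> less_point A p r"
  by (cases p; cases q; cases r) (auto dest: less_trans tag_less_trans)

lemma less_point_total:
  assumes "p \<in> points A" "q \<in> points A" "p \<noteq> q"
  shows "less_point A p q \<or> less_point A q p"
proof -
  obtain x t b y u c where [simp]: "p = (x, t, b)" "q = (y, u, c)" by (metis prod_cases3)
  have "x \<in> base A" "b \<in> base A" "y \<in> base A" "c \<in> base A"
    using assms points_base by auto
  then show ?thesis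
    using less_total[of x y] less_total[of b c] tag_less_total[of t u] assms(3) by auto
qed

lemma chain_arrow_asym: "chain_arrow A p q \<Longrightarrow> \<not> chain_arrow A q p"
  by (cases p; cases q) (auto dest: arrow_asym less_trans tag_less_trans)

lemma chain_arrow_total:
  assumes "p \<in> points A" "q \<in> points A" "p \<noteq> q"
  shows "chain_arrow A p q \<or> chain_arrow A q p"
proof -
  obtain x t b y u c where [simp]: "p = (x, t, b)" "q = (y, u, c)" by (metis prod_cases3)
  have "x \<in> base A" "b \<in> base A" "y \<in> base A" "c \<in> base A"
    using assms points_base by auto
  then show ?thesis
    using less_total[of x y] arrow_total[of b c] tag_less_total[of t u] assms(3) by auto
qed

text \<open>Points with the same last component relate alike to all points with another one. So the
  claim is local transitivity of the arrow for distinct last components, transitivity of the chain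
  order \<open>T\<close> for equal ones, and a matter of asymmetry in mixed cases.\<close>

lemma chain_arrow_local:
  assumes w: "chain_arrow A p w \<and> chain_arrow A q w \<and> chain_arrow A r w \<or>
       chain_arrow A w p \<and> chain_arrow A w q \<and> chain_arrow A w r"
    and "chain_arrow A p q" "chain_arrow A q r"
  shows "chain_arrow A p r"
proof -
  define b where "b = (\<lambda>p::point. snd (snd p))"
  define T where "T p q \<longleftrightarrow> tag_less (fst (snd p)) (fst (snd q)) \<or>
    fst (snd p) = fst (snd q) \<and> (fst p, fst q) \<in> binrel A Less" for p q :: point
  have T: "T p r" if "T p q" "T q r"
    using that by (auto simp: T_def dest: less_trans tag_less_trans)
  have C: "chain_arrow A p q \<longleftrightarrow> (b p, b q) \<in> binrel A Arrow \<or> b p = b q \<and> T p q" for p q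
    by (cases p; cases q) (auto simp: T_def b_def)
  show ?thesis
    using assms T arrow_local[of "b p" "b w" "b q" "b r"]
      arrow_asym[of "b p" "b q"] arrow_asym[of "b q" "b r"] arrow_asym[of "b p" "b r"] arrow_asym[of "b r" "b p"]
    unfolding C by auto
qed

end

text \<open>A local order is a tournament without diamonds, a diamond being a 3-cycle together with
  a source or a sink. Reversing all arrows at one vertex of a diamond yields a diamond again, so
  switching along any set of vertices preserves local orders.\<close>

lemma switch_local:
  fixes R :: "'a \<Rightarrow> 'a \<Rightarrow> bool" and s :: "'a \<Rightarrow> bool"
  defines "S \<equiv> \<lambda>x y. R x y \<noteq> (s x \<noteq> s y)"
  assumes asym: "\<And>x y. R x y \<Longrightarrow> \<not> R y x"
    and total: "\<And>x y. x \<in> V \<Longrightarrow> y \<in> V \<Longrightarrow> x \<noteq> y \<Longrightarrow> R x y \<or> R y x"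
    and local: "\<And>w x y z. R x w \<and> R y w \<and> R z w \<or> R w x \<and> R w y \<and> R w z \<Longrightarrow> R x y \<Longrightarrow> R y z \<Longrightarrow> R x z"
    and V: "w \<in> V" "x \<in> V" "y \<in> V" "z \<in> V"
    and w: "S x w \<and> S y w \<and> S z w \<or> S w x \<and> S w y \<and> S w z" and "S x y" "S y z"
  shows "S x z"
proof (rule ccontr)
  assume n: "\<not> S x z"
  have S_asym: "\<not> S b a" if "S a b" "a \<in> V" "b \<in> V" for a b
    using that asym total unfolding S_def by metis
  have d: "x \<noteq> w" "y \<noteq> w" "z \<noteq> w" "x \<noteq> y" "y \<noteq> z" "x \<noteq> z"
    using S_asym V w assms(10,11) by metis+
  have R: "R b a \<longleftrightarrow> \<not> R a b" if "a \<in> V" "b \<in> V" "a \<noteq> b" for a b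
    using that asym total by blast
  \<comment> \<open>With one orientation chosen for each of the six pairs, the claim is
    propositional in six arrows and four signs; the 24 instances of \<open>local\<close> exclude
    every diamond in \<open>R\<close>.\<close>
  note R' = R[OF V(1,2) d(1)[symmetric]] R[OF V(1,3) d(2)[symmetric]] R[OF V(1,4) d(3)[symmetric]]
    R[OF V(2,3) d(4)] R[OF V(3,4) d(5)] R[OF V(2,4) d(6)]
  show False
    using w assms(10,11) n
      local[of x w y z] local[of x w z y] local[of y w x z] local[of y w z x] local[of z w x y] local[of z w y x]
      local[of w x y z] local[of w x z y] local[of y x w z] local[of y x z w] local[of z x w y] local[of z x y w]
      local[of x y w z] local[of x y z w] local[of w y x z] local[of w y z x] local[of z y x w] local[of z y w x]
      local[of x z y w] local[of x z w y] local[of y z x w] local[of y z w x] local[of w z x y] local[of w z y x]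
    unfolding S_def R' by argo
qed

text \<open>The order is lexicographic, and the arrow is \<open>chain_arrow\<close> switched along
  the points with sign \<open>True\<close>.\<close>

lemma extension_olo:
  assumes "A \<in> ordered_local_orders"
  shows "extension A \<in> ordered_local_orders"
proof -
  interpret olo A by unfold_locales (fact assms)
  have tot: "p \<in> points A \<Longrightarrow> q \<in> points A \<Longrightarrow> p \<noteq> q \<Longrightarrow> point_rel A Arrow p q \<or> point_rel A Arrow q p" for p q
    using chain_arrow_total[of p q] chain_arrow_asym[of p q] unfolding point_rel.simps by argo
  have asy: "point_rel A Arrow p q \<Longrightarrow> p \<in> points A \<Longrightarrow> q \<in> points A \<Longrightarrow> \<not> point_rel A Arrow q p" for p q
    using chain_arrow_total[of p q] chain_arrow_asym[of p q] chain_arrow_asym[of p p]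
    unfolding point_rel.simps by (cases "p = q") blast+
  show ?thesis
    unfolding ordered_local_orders_iff binrel_extension universe_extension
  proof (intro conjI allI impI)
    fix m n assume "dec m \<in> points A" "dec n \<in> points A" "m \<noteq> n"
    moreover have "dec m \<noteq> dec n" using \<open>m \<noteq> n\<close> enc_dec by metis
    ultimately show "dec m \<in> points A \<and> dec n \<in> points A \<and> point_rel A Less (dec m) (dec n) \<or>
        dec n \<in> points A \<and> dec m \<in> points A \<and> point_rel A Less (dec n) (dec m)"
      "dec m \<in> points A \<and> dec n \<in> points A \<and> point_rel A Arrow (dec m) (dec n) \<or>
        dec n \<in> points A \<and> dec m \<in> points A \<and> point_rel A Arrow (dec n) (dec m)"
      using less_point_total tot by auto
  next
    fix w x y z
    assume w: "(dec x \<in> points A \<and> dec w \<in> points A \<and> point_rel A Arrow (dec x) (dec w)) \<and>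
       (dec y \<in> points A \<and> dec w \<in> points A \<and> point_rel A Arrow (dec y) (dec w)) \<and>
       dec z \<in> points A \<and> dec w \<in> points A \<and> point_rel A Arrow (dec z) (dec w) \<or>
       (dec w \<in> points A \<and> dec x \<in> points A \<and> point_rel A Arrow (dec w) (dec x)) \<and>
       (dec w \<in> points A \<and> dec y \<in> points A \<and> point_rel A Arrow (dec w) (dec y)) \<and>
       dec w \<in> points A \<and> dec z \<in> points A \<and> point_rel A Arrow (dec w) (dec z)"
      and xy: "dec x \<in> points A \<and> dec y \<in> points A \<and> point_rel A Arrow (dec x) (dec y)"
      and yz: "dec y \<in> points A \<and> dec z \<in> points A \<and> point_rel A Arrow (dec y) (dec z)"
    show "point_rel A Arrow (dec x) (dec z)"
      unfolding point_rel.simps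
    proof (rule switch_local[of "chain_arrow A" "points A" "dec w" "dec x" "dec y" "dec z"])
      show "chain_arrow A q p \<Longrightarrow> \<not> chain_arrow A p q" for p q by (rule chain_arrow_asym)
      show "p \<in> points A \<Longrightarrow> q \<in> points A \<Longrightarrow> p \<noteq> q \<Longrightarrow> chain_arrow A p q \<or> chain_arrow A q p" for p q
        by (rule chain_arrow_total)
      show "chain_arrow A p w \<and> chain_arrow A q w \<and> chain_arrow A r w \<or>
          chain_arrow A w p \<and> chain_arrow A w q \<and> chain_arrow A w r \<Longrightarrow>
          chain_arrow A p q \<Longrightarrow> chain_arrow A q r \<Longrightarrow> chain_arrow A p r" for p q r w
        by (rule chain_arrow_local)
    qed (use w xy yz in \<open>simp_all only: point_rel.simps, blast+\<close>)
  next
    show "is_structure olo_arity (extension A)" by (rule is_structure_extension)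
  next
    fix x y z
    assume "dec x \<in> points A \<and> dec y \<in> points A \<and> point_rel A Less (dec x) (dec y)"
      "dec y \<in> points A \<and> dec z \<in> points A \<and> point_rel A Less (dec y) (dec z)"
    then show "dec x \<in> points A" "dec z \<in> points A" "point_rel A Less (dec x) (dec z)"
      using less_point_trans[of "dec x" "dec y" "dec z"] by simp_all
  qed (use less_point_irrefl asy in \<open>(simp; fail) | blast\<close>)+
qed

section \<open>Lifting isomorphisms\<close>

lemma length_2E:
  assumes "length xs = 2"
  obtains x y where "xs = [x, y]"
  using assms by (auto simp: length_Suc_conv numeral_2_eq_2)

lemma embedding_universe: "f \<in> embeddings A B \<Longrightarrow> x \<in> universe A \<Longrightarrow> f x \<in> universe B"
  by (auto simp: embeddings_def)

lemma embedding_eq_iff: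
  assumes "f \<in> embeddings A B" "x \<in> universe A" "y \<in> universe A"
  shows "f x = f y \<longleftrightarrow> x = y"
proof -
  have "inj_on f (universe A)" using assms(1) by (simp add: embeddings_def)
  then show ?thesis using assms(2,3) by (rule inj_on_eq_iff)
qed

lemma embeddingI:
  assumes A: "is_structure olo_arity A" and B: "is_structure olo_arity B"
    and f: "f \<in> universe A \<rightarrow>\<^sub>E universe B" "inj_on f (universe A)"
    and rel: "\<And>r x y. x \<in> universe A \<Longrightarrow> y \<in> universe A \<Longrightarrow> (x, y) \<in> binrel A r \<longleftrightarrow> (f x, f y) \<in> binrel B r"
  shows "f \<in> embeddings A B"
proof -
  have "xs \<in> interp A r \<longleftrightarrow> map f xs \<in> interp B r" if xs: "xs \<in> lists (universe A)" for xs r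
  proof (cases "length xs = 2")
    case True
    then obtain x y where "xs = [x, y]" by (rule length_2E)
    then show ?thesis using rel[of x y r] xs by (simp add: binrel_def)
  next
    case False
    then show ?thesis using A B unfolding is_structure_def by fastforce
  qed
  then show ?thesis using f unfolding embeddings_def by blast
qed

text \<open>All old points carry the same tag and repeat their first component as the last, so the
  tie-breaking clauses never apply between them.\<close>

lemma old_incl_embedding:
  assumes "A \<in> ordered_local_orders"
  shows "old_incl A \<in> embeddings A (extension A)"
proof -
  interpret olo A by unfold_locales (fact assms)
  show ?thesis
  proof (rule embeddingI[OF olo_structure is_structure_extension])
    show "old_incl A \<in> universe A \<rightarrow>\<^sub>E universe (extension A)"
      by (auto simp: old_incl_def points_def)
    show "inj_on (old_incl A) (universe A)"
      by (rule inj_onI) (metis dec_enc old_incl_def old_point_def prod.inject restrict_apply')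
    fix r x y assume "x \<in> universe A" "y \<in> universe A"
    then show "(x, y) \<in> binrel A r \<longleftrightarrow> (old_incl A x, old_incl A y) \<in> binrel (extension A) r"
      by (cases r) (auto simp: old_incl_def points_def old_point_def point_sign_def)
  qed
qed

text \<open>The relations between points depend only on equality and the relations of base elements,
  on the signs and on the order of the tags. An isomorphism preserves the former, scaling by a
  positive factor the latter.\<close>

lemma lift_iso:
  assumes A: "A \<in> ordered_local_orders" and B: "B \<in> ordered_local_orders"
    and \<alpha>: "\<alpha> \<in> isos A B" and k: "k > 0"
  shows "lift A k \<alpha> \<in> isos (extension A) (extension B)"
proof -
  interpret A: olo A by unfold_locales (fact A)
  interpret B: olo B by unfold_locales (fact B)
  let ?g = "base_map A \<alpha>" and ?P = "point_map A \<alpha> k"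
  have im: "\<alpha> ` universe A = universe B" and inj: "inj_on \<alpha> (universe A)"
    and emb: "\<alpha> \<in> embeddings A B"
    using \<alpha> by (auto simp: isos_def embeddings_def)
  have g_im: "?g ` base A = base B"
    using im by (auto simp: base_def base_map_def)
  have g_eq: "?g x = ?g y \<longleftrightarrow> x = y" if "x \<in> base A" "y \<in> base A" for x y
    using that inj by (auto simp: base_def base_map_def inj_on_def split: if_splits)
  have g_rel: "(?g x, ?g y) \<in> binrel B r \<longleftrightarrow> (x, y) \<in> binrel A r" if "x \<in> base A" "y \<in> base A" for x y r
  proof (cases "universe A = {}")
    case True
    then show ?thesis using im A.binrel_universe B.binrel_universe by blast
  next
    case False
    then show ?thesis
      using that embeddings_binrel_iff[OF emb] by (simp add: base_map_def base_def)
  qed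
  have tag: "tag_less (k * q, s) (k * q', s') \<longleftrightarrow> tag_less (q, s) (q', s')" for q q' s s'
    using k by (simp add: tag_less_def)
  have P_in: "?P p \<in> points B" if "p \<in> points A" for p
  proof (cases "p \<in> old_point ` universe A")
    case True
    then obtain a where "a \<in> universe A" "p = old_point a" by blast
    moreover have "old_point (\<alpha> a) \<in> points B" using calculation(1) im by (auto simp: points_def)
    ultimately show ?thesis by (simp add: old_point_def base_map_def)
  next
    case False
    then show ?thesis using that k unfolding g_im[symmetric] points_def by auto
  qed
  have P_inj: "p = p'" if "p \<in> points A" "p' \<in> points A" "?P p = ?P p'" for p p'
  proof -
    obtain x q s b where [simp]: "p = (x, (q, s), b)" by (metis surj_pair)
    obtain x' q' s' b' where [simp]: "p' = (x', (q', s'), b')" by (metis surj_pair)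
    show ?thesis using that k A.points_base g_eq by auto
  qed
  have P_rel: "point_rel B r (?P p) (?P p') \<longleftrightarrow> point_rel A r p p'"
    if "p \<in> points A" "p' \<in> points A" for p p' r
  proof -
    obtain x q s b where [simp]: "p = (x, (q, s), b)" by (metis surj_pair)
    obtain x' q' s' b' where [simp]: "p' = (x', (q', s'), b')" by (metis surj_pair)
    have "x \<in> base A" "b \<in> base A" "x' \<in> base A" "b' \<in> base A"
      using that A.points_base by auto
    then show ?thesis using k by (cases r) (simp_all add: g_eq g_rel tag point_sign_def)
  qed
  have P_surj: "\<exists>p \<in> points A. ?P p = p'" if p': "p' \<in> points B" for p'
  proof (cases "p' \<in> old_point ` universe B")
    case True
    then have "p' \<in> old_point ` \<alpha> ` universe A" by (simp only: im)
    then obtain a where "a \<in> universe A" "p' = old_point (\<alpha> a)" by (elim imageE) simp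
    moreover have "old_point a \<in> points A" using calculation(1) by (simp add: points_def)
    ultimately show ?thesis by (intro bexI[of _ "old_point a"]) (simp_all add: old_point_def base_map_def)
  next
    case False
    obtain x' q s b' where [simp]: "p' = (x', (q, s), b')" by (metis surj_pair)
    have "q \<noteq> 0" using False p' by (auto simp: points_def)
    have "x' \<in> ?g ` base A" "b' \<in> ?g ` base A"
      unfolding g_im using B.points_base p' by auto
    then obtain x b where "x \<in> base A" "b \<in> base A" "x' = ?g x" "b' = ?g b" by blast
    then show ?thesis using \<open>q \<noteq> 0\<close> k
      by (intro bexI[of _ "(x, (q / k, s), b)"]) (auto simp: points_def)
  qed
  have "lift A k \<alpha> \<in> embeddings (extension A) (extension B)"
  proof (rule embeddingI[OF is_structure_extension is_structure_extension])
    show "lift A k \<alpha> \<in> universe (extension A) \<rightarrow>\<^sub>E universe (extension B)"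
      by (auto simp: lift_def P_in)
    show "inj_on (lift A k \<alpha>) (universe (extension A))"
    proof (rule inj_onI)
      fix m n
      assume mn: "m \<in> universe (extension A)" "n \<in> universe (extension A)" "lift A k \<alpha> m = lift A k \<alpha> n"
      then have "enc (?P (dec m)) = enc (?P (dec n))" by (simp add: lift_def)
      then have "?P (dec m) = ?P (dec n)" by (metis dec_enc)
      then have "dec m = dec n" using P_inj mn(1,2) by simp
      then show "m = n" by (metis enc_dec)
    qed
    fix r m n assume "m \<in> universe (extension A)" "n \<in> universe (extension A)"
    then show "(m, n) \<in> binrel (extension A) r \<longleftrightarrow> (lift A k \<alpha> m, lift A k \<alpha> n) \<in> binrel (extension B) r"
      by (simp add: lift_def P_in P_rel)
  qed
  moreover have "lift A k \<alpha> ` universe (extension A) = universe (extension B)"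
  proof (intro equalityI subsetI)
    fix n assume "n \<in> universe (extension B)"
    then obtain p where "p \<in> points A" "?P p = dec n" using P_surj[of "dec n"] by auto
    then show "n \<in> lift A k \<alpha> ` universe (extension A)"
      by (intro image_eqI[of _ _ "enc p"]) (simp_all add: lift_def)
  qed (auto simp: lift_def P_in)
  ultimately show ?thesis by (simp add: isos_def)
qed

section \<open>Witnesses\<close>

text \<open>Totality and transitivity are asked on \<open>F\<close> only, since a switched relation
  is known to be transitive only among the points considered. The converse of \<open>R\<close>
  yields least elements.\<close>

lemma finite_greatest:
  assumes "finite F" "F \<noteq> {}"
    and total: "\<And>x y. x \<in> F \<Longrightarrow> y \<in> F \<Longrightarrow> x \<noteq> y \<Longrightarrow> R x y \<or> R y x"
    and trans: "\<And>x y z. x \<in> F \<Longrightarrow> y \<in> F \<Longrightarrow> z \<in> F \<Longrightarrow> R x y \<Longrightarrow> R y z \<Longrightarrow> R x z"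
  shows "\<exists>m \<in> F. \<forall>x \<in> F. x \<noteq> m \<longrightarrow> R x m"
  using assms
proof (induction F rule: finite_ne_induct)
  case (singleton x)
  show ?case by simp
next
  case (insert a F)
  have "\<exists>m \<in> F. \<forall>x \<in> F. x \<noteq> m \<longrightarrow> R x m"
    by (rule insert.IH) (use insert.prems in \<open>blast+\<close>)
  then obtain m where m: "m \<in> F" "\<And>x. x \<in> F \<Longrightarrow> x \<noteq> m \<Longrightarrow> R x m" by blast
  have "R a m \<or> R m a"
    by (rule insert.prems(1)) (use m(1) insert.hyps in auto)
  then show ?case
  proof
    assume "R a m"
    then show ?thesis using m by (intro bexI[of _ m]) auto
  next
    assume ma: "R m a"
    have "R x a" if "x \<in> F" for x
      using insert.prems(2)[of x m a] m(1) m(2)[OF that] ma that by (cases "x = m") auto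
    then show ?thesis by (intro bexI[of _ a]) auto
  qed
qed

text \<open>Replacing the elements that do not point to \<open>z\<close> by their antipodes turns \<open>G\<close> into a set of
  predecessors of \<open>z\<close>, which is linearly ordered.  Its extremal elements are the neighbours of \<open>z\<close>
  and of the antipode of \<open>z\<close>.\<close>

lemma switched_extremal:
  assumes B: "B \<in> ordered_local_orders" and z: "z \<in> universe B"
    and G: "finite G" "G \<noteq> {}" "G \<subseteq> universe B" "z \<notin> G"
    and s: "\<And>a. s a \<longleftrightarrow> (a, z) \<notin> binrel B Arrow"
  shows "\<exists>b \<in> G. \<forall>a \<in> G. a \<noteq> b \<longrightarrow> ((a, b) \<in> binrel B Arrow \<longleftrightarrow> s a = s b)"
    and "\<exists>b \<in> G. \<forall>a \<in> G. a \<noteq> b \<longrightarrow> ((a, b) \<in> binrel B Arrow \<longleftrightarrow> s a \<noteq> s b)"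
proof -
  interpret olo B by unfold_locales (fact B)
  let ?R = "\<lambda>x y. (x, y) \<in> binrel B Arrow"
  have G_base: "x \<in> base B" if "x \<in> G" for x using that G(3) by (auto simp: base_def)
  have total: "?R x y \<or> ?R y x" if "x \<in> insert z G" "y \<in> insert z G" "x \<noteq> y" for x y
  proof -
    have "z \<in> base B" using z by (auto simp: base_def)
    then show ?thesis using that G_base by (intro arrow_total) auto
  qed
  \<comment> \<open>\<open>s z\<close> holds by irreflexivity of the arrow, but \<open>z\<close>
    itself must not be switched, so its sign is reset.\<close>
  define s' where "s' = s(z := False)"
  have s': "s' x = s x" if "x \<in> G" for x
    using that G(4) by (auto simp: s'_def)
  define S where "S x y \<longleftrightarrow> ?R x y \<noteq> (s' x \<noteq> s' y)" for x y
  have Sz: "S x z" if "x \<in> G" for x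
    using s'[OF that] by (simp add: S_def s) (simp add: s'_def)
  have S_total: "S x y \<or> S y x" if "x \<in> G" "y \<in> G" "x \<noteq> y" for x y
    using that total[of x y] arrow_asym unfolding S_def by blast
  have S_trans: "S x v" if "x \<in> G" "y \<in> G" "v \<in> G" "S x y" "S y v" for x y v
    unfolding S_def
  proof (rule switch_local[of ?R "insert z G" z x y v s'])
    show "(?R x z \<noteq> (s' x \<noteq> s' z)) \<and> (?R y z \<noteq> (s' y \<noteq> s' z)) \<and> (?R v z \<noteq> (s' v \<noteq> s' z)) \<or>
        (?R z x \<noteq> (s' z \<noteq> s' x)) \<and> (?R z y \<noteq> (s' z \<noteq> s' y)) \<and> (?R z v \<noteq> (s' z \<noteq> s' v))"
      using Sz that(1-3) unfolding S_def by blast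
    show "?R x y \<noteq> (s' x \<noteq> s' y)" "?R y v \<noteq> (s' y \<noteq> s' v)"
      using that(4,5) unfolding S_def by fast+
  qed (use that(1-3) arrow_asym total arrow_local in \<open>blast+\<close>)
  have S_asym: "S x y \<longleftrightarrow> \<not> S y x" if "x \<in> G" "y \<in> G" "x \<noteq> y" for x y
    using that total[of x y] arrow_asym unfolding S_def by blast
  obtain b where "b \<in> G" "\<forall>a \<in> G. a \<noteq> b \<longrightarrow> S a b"
    using finite_greatest[of G S] G S_total S_trans by blast
  then show "\<exists>b \<in> G. \<forall>a \<in> G. a \<noteq> b \<longrightarrow> ((a, b) \<in> binrel B Arrow \<longleftrightarrow> s a = s b)"
    unfolding S_def using s' by metis
  obtain b where "b \<in> G" "\<forall>a \<in> G. a \<noteq> b \<longrightarrow> S b a"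
    using finite_greatest[of G "\<lambda>x y. S y x"] G S_total S_trans by blast
  then have "b \<in> G" "\<forall>a \<in> G. a \<noteq> b \<longrightarrow> \<not> S a b" using S_asym by blast+
  then show "\<exists>b \<in> G. \<forall>a \<in> G. a \<noteq> b \<longrightarrow> ((a, b) \<in> binrel B Arrow \<longleftrightarrow> s a \<noteq> s b)"
    unfolding S_def using s' by metis
qed

text \<open>One displacement \<open>q\<close> must serve both relations. The order fixes its sign:
  \<open>z\<close> lies just above its greatest predecessor in \<open>F\<close> or, failing that,
  just below the least element of \<open>F\<close>. On the circle \<open>z\<close> has a neighbour
  on either side among the elements of \<open>F\<close> and their antipodes, so \<open>b\<close> can
  be picked on the side that the sign of \<open>q\<close> requires.\<close>

lemma witness_point:
  assumes A: "A \<in> ordered_local_orders" and B: "B \<in> ordered_local_orders"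
    and f: "f \<in> embeddings A B" and F: "finite F" "F \<subseteq> universe A"
    and z: "z \<in> universe B" "z \<notin> f ` F"
  obtains x q s b where "x \<in> base A" "b \<in> base A" "q \<noteq> 0"
    "\<And>r a. a \<in> F \<Longrightarrow> point_rel A r (old_point a) (x, (q, s), b) \<longleftrightarrow> (f a, z) \<in> binrel B r"
proof (cases "F = {}")
  case True
  \<comment> \<open>Without parameters any new point will do; only an element of the base has to be
    named.\<close>
  have "(if universe A = {} then 0 else SOME a. a \<in> universe A) \<in> base A"
    by (auto simp: base_def some_in_eq)
  then show ?thesis using that[of _ _ 1] True by auto
next
  case False
  interpret A: olo A by unfold_locales (fact A)
  interpret B: olo B by unfold_locales (fact B)
  have Fb: "a \<in> base A" if "a \<in> F" for a using that F(2) by (auto simp: base_def)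
  have rel: "(f x, f y) \<in> binrel B r \<longleftrightarrow> (x, y) \<in> binrel A r" if "x \<in> F" "y \<in> F" for x y r
    using embeddings_binrel_iff[OF f] that F(2) by blast
  have fF: "f ` F \<subseteq> universe B" using embedding_universe[OF f] F(2) by blast
  have finj: "f x = f y \<longleftrightarrow> x = y" if "x \<in> F" "y \<in> F" for x y
    using embedding_eq_iff[OF f] that F(2) by blast
  define s where "s = (\<lambda>a. (a, z) \<notin> binrel B Arrow)"
  have s: "s a \<longleftrightarrow> (a, z) \<notin> binrel B Arrow" for a by (simp add: s_def)
  have Fi: "finite (f ` F)" "f ` F \<noteq> {}" using F False by auto
  \<comment> \<open>The left side is \<open>less_point\<close> from \<open>old_point a\<close> to
    the point sought: the tag of an old point lies below that of a new one exactly if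
    \<open>0 < q\<close>.\<close>
  have ex: "\<exists>x \<in> F. \<exists>q :: rat. q \<noteq> 0 \<and>
    (\<forall>a \<in> F. (a, x) \<in> binrel A Less \<or> a = x \<and> 0 < q \<longleftrightarrow> (f a, z) \<in> binrel B Less)"
  proof (cases "\<exists>a \<in> F. (f a, z) \<in> binrel B Less")
    case True
    let ?L = "{a \<in> F. (f a, z) \<in> binrel B Less}"
    have "finite ?L" "?L \<noteq> {}" using F True by auto
    then have "\<exists>m \<in> ?L. \<forall>x \<in> ?L. x \<noteq> m \<longrightarrow> (x, m) \<in> binrel A Less"
      by (rule finite_greatest) (use A.less_total A.less_trans Fb in blast)+
    then obtain m where m: "m \<in> F" "(f m, z) \<in> binrel B Less"
      "\<And>a. a \<in> F \<Longrightarrow> (f a, z) \<in> binrel B Less \<Longrightarrow> a \<noteq> m \<Longrightarrow> (a, m) \<in> binrel A Less" by blast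
    have "(f a, z) \<in> binrel B Less" if "a \<in> F" "(a, m) \<in> binrel A Less" for a
      using that m(1,2) rel B.less_trans by blast
    then show ?thesis using m by (intro bexI[of _ m] exI[of _ "1 :: rat"]) auto
  next
    case none: False
    have "\<exists>m \<in> F. \<forall>x \<in> F. x \<noteq> m \<longrightarrow> (m, x) \<in> binrel A Less"
      by (rule finite_greatest[of F "\<lambda>x y. (y, x) \<in> binrel A Less"])
        (use F(1) False A.less_total A.less_trans Fb in blast)+
    then obtain m where m: "m \<in> F" "\<And>x. x \<in> F \<Longrightarrow> x \<noteq> m \<Longrightarrow> (m, x) \<in> binrel A Less" by blast
    have "(a, m) \<notin> binrel A Less" if "a \<in> F" for a
      using m(2)[OF that] A.less_trans[of m a m] A.less_irrefl by (cases "a = m") blast+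
    then show ?thesis
      using none m(1) by (intro bexI[of _ m] exI[of _ "-1 :: rat"]) auto
  qed
  then obtain x and q :: rat where x: "x \<in> F" and q: "q \<noteq> 0"
    and less: "\<And>a. a \<in> F \<Longrightarrow> (a, x) \<in> binrel A Less \<or> a = x \<and> 0 < q \<longleftrightarrow> (f a, z) \<in> binrel B Less"
    by blast
  obtain b \<sigma> where b: "b \<in> F" and arrow:
    "\<And>a. a \<in> F \<Longrightarrow> ((a, b) \<in> binrel A Arrow \<or> a = b \<and> 0 < q) \<noteq> \<sigma> \<longleftrightarrow> (f a, z) \<in> binrel B Arrow"
  proof (cases "0 < q")
    case True
    \<comment> \<open>After switching, \<open>b'\<close> is the last element before
      \<open>z\<close>, so \<open>z\<close> directly follows \<open>b'\<close> or its antipode,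
      according to \<open>s b'\<close>.\<close>
    obtain b' where b': "b' \<in> f ` F"
      "\<And>a. a \<in> f ` F \<Longrightarrow> a \<noteq> b' \<Longrightarrow> (a, b') \<in> binrel B Arrow \<longleftrightarrow> s a = s b'"
      using switched_extremal(1)[OF B z(1) Fi fF z(2) s] by blast
    obtain b where b: "b \<in> F" "b' = f b" using b'(1) by blast
    have "(a, b) \<in> binrel A Arrow \<longleftrightarrow> s (f a) = s (f b)" if "a \<in> F" "a \<noteq> b" for a
      using b'(2)[of "f a"] that rel[OF that(1) b(1)] finj[OF that(1) b(1)] b(2) by simp
    then have "((a, b) \<in> binrel A Arrow \<or> a = b \<and> 0 < q) \<noteq> (s (f b)) \<longleftrightarrow> (f a, z) \<in> binrel B Arrow"
      if "a \<in> F" for a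
      using that True A.arrow_irrefl[of b] s by (cases "a = b") auto
    then show ?thesis by (rule that[OF b(1)])
  next
    case False
    \<comment> \<open>Now \<open>b'\<close> is the first element after switching. The antipode of
      the switched element comes directly after \<open>z\<close>, whence the complemented sign
      below.\<close>
    obtain b' where b': "b' \<in> f ` F"
      "\<And>a. a \<in> f ` F \<Longrightarrow> a \<noteq> b' \<Longrightarrow> (a, b') \<in> binrel B Arrow \<longleftrightarrow> s a \<noteq> s b'"
      using switched_extremal(2)[OF B z(1) Fi fF z(2) s] by blast
    obtain b where b: "b \<in> F" "b' = f b" using b'(1) by blast
    have "(a, b) \<in> binrel A Arrow \<longleftrightarrow> s (f a) \<noteq> s (f b)" if "a \<in> F" "a \<noteq> b" for a
      using b'(2)[of "f a"] that rel[OF that(1) b(1)] finj[OF that(1) b(1)] b(2) by simp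
    then have "((a, b) \<in> binrel A Arrow \<or> a = b \<and> 0 < q) \<noteq> (\<not> s (f b)) \<longleftrightarrow> (f a, z) \<in> binrel B Arrow"
      if "a \<in> F" for a
      using that False A.arrow_irrefl[of b] s by (cases "a = b") auto
    then show ?thesis by (rule that[OF b(1)])
  qed
  show ?thesis
  proof (rule that[of x b q \<sigma>])
    fix r a assume "a \<in> F"
    then show "point_rel A r (old_point a) (x, (q, \<sigma>), b) \<longleftrightarrow> (f a, z) \<in> binrel B r"
      using less[of a] arrow[of a] q
      by (cases r) (auto simp: old_point_def tag_less_def point_sign_def)
  qed (use x b q Fb in auto)
qed

lemma qf_sat_cong:
  assumes A: "is_structure olo_arity A" and B: "is_structure olo_arity B"
    and eq: "\<And>s t. term_params s \<subseteq> F \<Longrightarrow> term_params t \<subseteq> F \<Longrightarrow>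
      term_val f x s = term_val f x t \<longleftrightarrow> term_val g y s = term_val g y t"
    and rel: "\<And>r s t. term_params s \<subseteq> F \<Longrightarrow> term_params t \<subseteq> F \<Longrightarrow>
      (term_val f x s, term_val f x t) \<in> binrel A r \<longleftrightarrow> (term_val g y s, term_val g y t) \<in> binrel B r"
    and "well_formed olo_arity \<psi>" "params \<psi> \<subseteq> F"
  shows "qf_sat A f x \<psi> \<longleftrightarrow> qf_sat B g y \<psi>"
  using assms(5,6)
proof (induction \<psi>)
  case (Equal s t)
  then show ?case using eq by simp
next
  case (Atom r ts)
  then have "length ts = 2" by simp
  then obtain s t where "ts = [s, t]" by (rule length_2E)
  then show ?case using rel[of s t r] Atom by (simp add: binrel_def)
qed simp_all

lemma extension_witness:
  assumes A: "A \<in> ordered_local_orders" and adm: "admissible olo_arity ordered_local_orders A \<tau>"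
  shows "\<exists>c. realizes (extension A) (old_incl A) c \<tau>"
proof -
  obtain F where F: "finite F" "F \<subseteq> universe A"
    and \<tau>: "\<And>\<psi>. \<psi> \<in> \<tau> \<Longrightarrow> well_formed olo_arity \<psi> \<and> params \<psi> \<subseteq> F"
    using adm unfolding admissible_def finite_qf_type_def by blast
  obtain B f z where B: "B \<in> ordered_local_orders" and f: "f \<in> embeddings A B"
    and z: "realizes B f z \<tau>"
    using adm unfolding admissible_def by blast
  interpret B: olo B by unfold_locales (fact B)
  interpret E: olo "extension A" by unfold_locales (rule extension_olo[OF A])
  have zB: "z \<in> universe B" using z by (simp add: realizes_def)
  let ?\<iota> = "old_incl A"
  note \<iota> = old_incl_embedding[OF A]
  have \<iota>_in: "?\<iota> a \<in> universe (extension A)" if "a \<in> F" for a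
    using embedding_universe[OF \<iota>] that F(2) by blast
  have f_in: "f a \<in> universe B" if "a \<in> F" for a
    using embedding_universe[OF f] that F(2) by blast
  have ff_eq: "f a = f a' \<longleftrightarrow> ?\<iota> a = ?\<iota> a'" if "a \<in> F" "a' \<in> F" for a a'
    using embedding_eq_iff[OF f, of a a'] embedding_eq_iff[OF \<iota>, of a a'] that F(2) by blast
  have ff_rel: "(f a, f a') \<in> binrel B r \<longleftrightarrow> (?\<iota> a, ?\<iota> a') \<in> binrel (extension A) r" if "a \<in> F" "a' \<in> F" for a a' r
    using embeddings_binrel_iff[OF f] embeddings_binrel_iff[OF \<iota>] that F(2) by blast
  \<comment> \<open>Only the parameters in \<open>F\<close> count, so a new point may serve even if
    \<open>z\<close> is the image of an element of \<open>A\<close> outside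
    \<open>F\<close>.\<close>
  have "\<exists>c \<in> universe (extension A). (\<forall>a \<in> F. (f a = z \<longleftrightarrow> ?\<iota> a = c) \<and>
    (\<forall>r. (f a, z) \<in> binrel B r \<longleftrightarrow> (?\<iota> a, c) \<in> binrel (extension A) r))"
  proof (cases "z \<in> f ` F")
    case True
    then obtain a where "a \<in> F" "z = f a" by blast
    then show ?thesis using ff_eq ff_rel \<iota>_in by (intro bexI[of _ "?\<iota> a"]) auto
  next
    case False
    obtain x q s b where w: "x \<in> base A" "b \<in> base A" "q \<noteq> 0"
      "\<And>r a. a \<in> F \<Longrightarrow> point_rel A r (old_point a) (x, (q, s), b) \<longleftrightarrow> (f a, z) \<in> binrel B r"
      using witness_point[OF A B f F zB False] by metis
    have p: "(x, (q, s), b) \<in> points A" using w(1-3) by (simp add: points_def)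
    show ?thesis
    proof (intro bexI[of _ "enc (x, (q, s), b)"] ballI conjI allI)
      fix a assume a: "a \<in> F"
      then have \<iota>a: "?\<iota> a = enc (old_point a)" using F(2) by (auto simp: old_incl_def)
      have "?\<iota> a \<noteq> enc (x, (q, s), b)"
        unfolding \<iota>a using w(3) by (metis dec_enc fst_conv old_point_def snd_conv)
      then show "f a = z \<longleftrightarrow> ?\<iota> a = enc (x, (q, s), b)" using False a by blast
      show "(f a, z) \<in> binrel B r \<longleftrightarrow> (?\<iota> a, enc (x, (q, s), b)) \<in> binrel (extension A) r" for r
        using w(4)[OF a] p \<iota>_in[OF a] by (simp add: \<iota>a)
    qed (use p in simp)
  qed
  then obtain c where c: "c \<in> universe (extension A)"
    and c_eq: "\<And>a. a \<in> F \<Longrightarrow> f a = z \<longleftrightarrow> ?\<iota> a = c"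
    and c_rel: "\<And>a r. a \<in> F \<Longrightarrow> (f a, z) \<in> binrel B r \<longleftrightarrow> (?\<iota> a, c) \<in> binrel (extension A) r"
    by blast
  have c_eq': "z = f a \<longleftrightarrow> c = ?\<iota> a" if "a \<in> F" for a
    using c_eq[OF that] by metis
  \<comment> \<open>Between different elements exactly one direction of each relation holds, so the
    relations from the parameters to \<open>z\<close> determine those from \<open>z\<close> to the
    parameters.\<close>
  have flip: "(v, u) \<in> binrel M r \<longleftrightarrow> u \<noteq> v \<and> (u, v) \<notin> binrel M r"
    if "M \<in> ordered_local_orders" "u \<in> universe M" "v \<in> universe M" for M u v r
  proof -
    interpret olo M by unfold_locales (fact that(1))
    have "u \<in> base M" "v \<in> base M" using that by (auto simp: base_def)
    then show ?thesis
      using less_total[of u v] arrow_total[of u v] arrow_asym less_trans[of u v u] less_irrefl arrow_irrefl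
      by (cases r) metis+
  qed
  have c_rel': "(z, f a) \<in> binrel B r \<longleftrightarrow> (c, ?\<iota> a) \<in> binrel (extension A) r" if a: "a \<in> F" for a r
    unfolding flip[OF B f_in[OF a] zB] flip[OF E.olo \<iota>_in[OF a] c] using c_eq[OF a] c_rel[OF a] by simp
  have irr: "(u, u) \<notin> binrel M r" if "M \<in> ordered_local_orders" for M u r
    using that olo.less_irrefl[OF olo.intro] olo.arrow_irrefl[OF olo.intro] by (cases r) auto
  have "qf_sat B f z \<psi> \<longleftrightarrow> qf_sat (extension A) ?\<iota> c \<psi>" if "\<psi> \<in> \<tau>" for \<psi>
  proof (rule qf_sat_cong[OF B.olo_structure is_structure_extension, where F = F])
    fix s t assume "term_params s \<subseteq> F" "term_params t \<subseteq> F"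
    then show "term_val f z s = term_val f z t \<longleftrightarrow> term_val ?\<iota> c s = term_val ?\<iota> c t"
      using c_eq c_eq' ff_eq by (cases s; cases t) simp_all
    show "(term_val f z s, term_val f z t) \<in> binrel B r \<longleftrightarrow>
        (term_val ?\<iota> c s, term_val ?\<iota> c t) \<in> binrel (extension A) r" for r
      using \<open>term_params s \<subseteq> F\<close> \<open>term_params t \<subseteq> F\<close> c_rel c_rel' ff_rel irr[OF B] irr[OF E.olo]
      by (cases s; cases t) (simp_all del: binrel_extension)
  qed (use \<tau> that in auto)
  then show ?thesis using z c unfolding realizes_def by blast
qed

section \<open>Measurability\<close>

lemma pred_points [measurable]: "Measurable.pred struct_borel (\<lambda>A. p \<in> points A)"
proof -
  obtain x q s b where p: "p = (x, (q, s), b)" by (metis surj_pair)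
  \<comment> \<open>Emptiness of the universe is spelled out by a quantifier over
    \<open>nat\<close>, so that only countably many coordinate conditions occur.\<close>
  have "p \<in> points A \<longleftrightarrow> (x \<in> universe A \<or> x = 0 \<and> (\<forall>n. n \<notin> universe A)) \<and>
      (b \<in> universe A \<or> b = 0 \<and> (\<forall>n. n \<notin> universe A)) \<and> q \<noteq> 0 \<or>
      x \<in> universe A \<and> q = 0 \<and> \<not> s \<and> b = x" for A :: "'a rstruct"
    by (auto simp: p points_def old_point_def base_def)
  then show ?thesis by (simp only:) measurable
qed

lemma pred_point_rel [measurable]: "Measurable.pred struct_borel (\<lambda>A. point_rel A r p p')"
proof -
  obtain x t b y u c where [simp]: "p = (x, t, b)" "p' = (y, u, c)" by (metis prod_cases3)
  show ?thesis by (cases r; simp only: point_rel.simps less_point.simps chain_arrow.simps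
      binrel_def mem_Collect_eq case_prod_conv \<open>p = _\<close> \<open>p' = _\<close>; measurable)
qed

text \<open>It suffices to test the preimages of the generating coordinate sets.\<close>

lemma measurable_extension: "extension \<in> struct_borel \<rightarrow>\<^sub>M struct_borel"
proof -
  have "Measurable.pred struct_borel (\<lambda>A. n \<in> universe (extension A))" for n
    by simp
  moreover have "Measurable.pred struct_borel (\<lambda>A. xs \<in> interp (extension A) r)" for xs r
    unfolding extension_def by simp measurable
  ultimately show ?thesis
    unfolding pred_def
    by (subst (2) struct_borel_def) (auto intro!: measurable_measure_of
      simp: vimage_def Int_def struct_borel_def space_measure_of_conv)
qed

lemma measurable_borel_nat: "M \<rightarrow>\<^sub>M (borel :: nat measure) = M \<rightarrow>\<^sub>M count_space UNIV"
  by (rule measurable_cong_sets[OF refl sets_borel_eq_count_space])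

lemma measurable_fun_nat:
  fixes f :: "'a \<Rightarrow> nat \<Rightarrow> nat"
  assumes "\<And>n. (\<lambda>x. f x n) \<in> M \<rightarrow>\<^sub>M count_space UNIV"
  shows "f \<in> M \<rightarrow>\<^sub>M borel"
  by (rule measurable_coordinatewise_then_product)
    (simp add: measurable_borel_nat assms)

lemma measurable_old_incl: "old_incl \<in> struct_borel \<rightarrow>\<^sub>M borel"
  by (rule measurable_fun_nat) (simp add: old_incl_def restrict_def)

text \<open>For fixed \<open>n\<close> the point \<open>dec n\<close> is constant. The value at
  \<open>n\<close> is then decided by membership of fixed elements in \<open>points A\<close> and in
  the universe, and by the values of \<phi> at two fixed numbers.\<close>

lemma measurable_lift: "(\<lambda>(A, \<phi>). lift A k \<phi>) \<in> struct_borel \<Otimes>\<^sub>M borel \<rightarrow>\<^sub>M borel"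
proof (rule measurable_fun_nat)
  fix n
  obtain x q s b where p: "dec n = (x, (q, s), b)" by (metis surj_pair)
  have [measurable]: "(\<lambda>\<phi>. \<phi> m) \<in> (borel :: (nat \<Rightarrow> nat) measure) \<rightarrow>\<^sub>M count_space UNIV" for m
    unfolding measurable_borel_nat[symmetric] by (rule measurable_product_coordinates)
  show "(\<lambda>w. (case w of (A, \<phi>) \<Rightarrow> lift A k \<phi>) n) \<in> struct_borel \<Otimes>\<^sub>M borel \<rightarrow>\<^sub>M count_space UNIV"
    unfolding lift_def restrict_def universe_extension p point_map.simps base_map_def case_prod_beta
    by measurable
qed

section \<open>Choice of the scaling factors and verification of the three conditions\<close>

theorem theorem4p2: "ABAP olo_arity ordered_local_orders"
proof -
  let ?K = ordered_local_orders
  \<comment> \<open>An old point has displacement 0, which every factor \<open>k\<close>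
    fixes.\<close>
  have lift_old: "lift A k \<alpha> (old_incl A x) = old_incl B (\<alpha> x)"
    if "\<alpha> \<in> isos A B" "x \<in> universe A" for A B k \<alpha> x
  proof -
    have "\<alpha> x \<in> universe B" using that by (auto simp: isos_def)
    then show ?thesis
      using that(2) by (simp add: lift_def old_incl_def points_def) (simp add: old_point_def base_map_def)
  qed
  \<comment> \<open>Since \<open>lift\<close> is \<open>undefined\<close> outside its domain, a
    composition can be unfolded only once the intermediate points are known to lie there.\<close>
  have lift_in: "dec n \<in> points A \<Longrightarrow> point_map A \<alpha> k (dec n) \<in> points B"
    if "A \<in> ?K" "B \<in> ?K" "\<alpha> \<in> isos A B" "k > 0" for A B \<alpha> k n
  proof -
    assume n: "dec n \<in> points A"
    then have "lift A k \<alpha> n \<in> universe (extension B)"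
      using lift_iso[OF that] by (auto simp: isos_def embeddings_def)
    then show ?thesis using n by (simp add: lift_def)
  qed
  show ?thesis
    unfolding ABAP_def
  \<comment> \<open>Displacements are scaled by 2 for every automorphism, the identity included, and
    by 1 for isomorphisms between structures.\<close>
  proof (intro exI[of _ extension] exI[of _ old_incl] exI[of _ "\<lambda>(A, \<phi>). lift A 2 \<phi>"]
      exI[of _ "\<lambda>A B \<alpha>. lift A 1 \<alpha>"] conjI ballI allI impI)
    show "extension \<in> restrict_space struct_borel ?K \<rightarrow>\<^sub>M restrict_space struct_borel ?K"
      by (rule measurable_restrict_space2)
        (auto simp: space_restrict_space extension_olo intro: measurable_restrict_space1 measurable_extension)
    show "old_incl \<in> restrict_space struct_borel ?K \<rightarrow>\<^sub>M borel"
      by (rule measurable_restrict_space1[OF measurable_old_incl])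
    show "(\<lambda>(A, \<phi>). lift A 2 \<phi>) \<in> restrict_space (struct_borel \<Otimes>\<^sub>M borel) (SIGMA A : ?K. Aut A) \<rightarrow>\<^sub>M borel"
      by (rule measurable_restrict_space1[OF measurable_lift])
  next
    fix A assume A: "A \<in> ?K"
    show "old_incl A \<in> embeddings A (extension A)" by (rule old_incl_embedding[OF A])
    show "\<exists>c. realizes (extension A) (old_incl A) c \<tau>" if "admissible olo_arity ?K A \<tau>" for \<tau>
      by (rule extension_witness[OF A that])
    fix \<phi> assume \<phi>: "\<phi> \<in> Aut A"
    show "(case (A, \<phi>) of (A, \<phi>) \<Rightarrow> lift A 2 \<phi>) \<in> Aut (extension A)"
      using lift_iso[OF A A] \<phi> by (simp add: Aut_def)
    show "(case (A, \<phi>) of (A, \<phi>) \<Rightarrow> lift A 2 \<phi>) (old_incl A x) = old_incl A (\<phi> x)" if "x \<in> universe A" for x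
      using lift_old \<phi> that by (simp add: Aut_def)
    fix n assume n: "n \<in> universe (extension A) - old_incl A ` universe A"
    obtain x q s b where p: "dec n = (x, (q, s), b)" by (metis surj_pair)
    have "n \<noteq> enc (old_point a)" if "a \<in> universe A" for a
      using n that by (auto simp: old_incl_def)
    then have "dec n \<notin> old_point ` universe A" by (metis enc_dec imageE)
    then have "q \<noteq> 0" using n by (auto simp: p points_def)
    then have "point_map A \<phi> 2 (dec n) \<noteq> dec n" by (simp add: p)
    then have "enc (point_map A \<phi> 2 (dec n)) \<noteq> n" by (metis dec_enc)
    then show "(case (A, \<phi>) of (A, \<phi>) \<Rightarrow> lift A 2 \<phi>) n \<noteq> n"
      using n by (simp add: lift_def)
  next
    fix A B \<alpha> assume A: "A \<in> ?K" and B: "B \<in> ?K" and \<alpha>: "\<alpha> \<in> isos A B"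
    show "lift A 1 \<alpha> \<in> isos (extension A) (extension B)" by (rule lift_iso[OF A B \<alpha>]) simp
    show "lift A 1 \<alpha> (old_incl A x) = old_incl B (\<alpha> x)" if "x \<in> universe A" for x
      by (rule lift_old[OF \<alpha> that])
    fix \<phi> \<psi> n
    assume \<phi>: "\<phi> \<in> Aut A" and \<psi>: "\<psi> \<in> Aut B"
      and comm: "\<forall>x \<in> universe A. \<alpha> (\<phi> x) = \<psi> (\<alpha> x)" and n: "n \<in> universe (extension A)"
    have \<phi>_in: "\<phi> x \<in> universe A \<longleftrightarrow> True" if "x \<in> universe A" for x
      using \<phi> that by (auto simp: Aut_def isos_def)
    have \<alpha>_in: "\<alpha> x \<in> universe B" if "x \<in> universe A" for x
      using \<alpha> that by (auto simp: isos_def)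
    \<comment> \<open>This case occurs only if both universes are empty; both sides of the next
      equation are then \<open>0\<close>.\<close>
    have outside: "x \<notin> universe B" if "x \<in> base A" "x \<notin> universe A" for x
      using that \<alpha> by (auto simp: isos_def base_def split: if_splits)
    have base: "base_map A \<alpha> (base_map A \<phi> x) = base_map B \<psi> (base_map A \<alpha> x)" if "x \<in> base A" for x
      using comm \<phi>_in \<alpha>_in outside that by (simp add: base_map_def)
    obtain x q s b where p: "dec n = (x, (q, s), b)" by (metis surj_pair)
    have "x \<in> base A" "b \<in> base A"
      using n olo.points_base[OF olo.intro[OF A]] by (auto simp: p)
    then have "point_map A \<alpha> 1 (point_map A \<phi> 2 (dec n)) = point_map B \<psi> 2 (point_map A \<alpha> 1 (dec n))"
      by (simp add: p base)
    moreover have "point_map A \<phi> 2 (dec n) \<in> points A" "point_map A \<alpha> 1 (dec n) \<in> points B"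
      using lift_in n A B \<alpha> \<phi> by (simp_all add: Aut_def)
    ultimately show "lift A 1 \<alpha> ((case (A, \<phi>) of (A, \<phi>) \<Rightarrow> lift A 2 \<phi>) n) =
        (case (B, \<psi>) of (A, \<phi>) \<Rightarrow> lift A 2 \<phi>) (lift A 1 \<alpha> n)"
      using n by (simp add: lift_def)
  qed
qed

end
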